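(* Let $f\in\mathcal{S}$ and let $\gamma_2,\gamma_3$ be its logarithmic coefficients. Then $$|\gamma_3|-|\gamma_2|\le \frac{1}{\sqrt{5}}.$$
   Context: Let $\mathbb{D}=\{z\in\mathbb{C}:|z|<1\}$. $\mathcal{S}$ denotes the class of functions $f$ analytic and univalent in $\mathbb{D}$ with the normalization $f(z)=z+a_2z^2+a_3z^3+\cdots$ (i.e. $f(0)=0$, $f'(0)=1$). The logarithmic coefficients $\gamma_n$ of $f\in\mathcal{S}$ are defined by $$\log\frac{f(z)}{z}=2\sum_{n=1}^{\infty}\gamma_n z^n,\qquad z\in\mathbb{D},$$ where the branch of the logarithm is the one equal to $0$ at $z=0$. In particular $\gamma_2=\tfrac12\left(a_3-\tfrac12a_2^2\right)$ and $\gamma_3=\tfrac12\left(a_4-a_2a_3+\tfrac13a_2^3\right)$. *)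

theory Defs
  imports "HOL-Complex_Analysis.Complex_Analysis"
begin

definition class_S :: "(complex \<Rightarrow> complex) set" where
  "class_S = {f. f holomorphic_on ball 0 1 \<and> inj_on f (ball 0 1) \<and> f 0 = 0 \<and> deriv f 0 = 1}"

definition log_branch :: "(complex \<Rightarrow> complex) \<Rightarrow> (complex \<Rightarrow> complex)" where
  "log_branch f = (THE L. L holomorphic_on ball 0 1 \<and> L 0 = 0 \<and>
      (\<forall>z\<in>ball 0 1. z \<noteq> 0 \<longrightarrow> exp (L z) = f z / z) \<and>
      (\<forall>z. z \<notin> ball 0 1 \<longrightarrow> L z = 0))"

text \<open>Logarithmic coefficients: log (f z / z) = 2 * sum gamma_n z^n.\<close>
definition log_coeff :: "(complex \<Rightarrow> complex) \<Rightarrow> nat \<Rightarrow> complex" where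
  "log_coeff f n = (deriv ^^ n) (log_branch f) 0 / (2 * of_nat (fact n))"

end

theory Submission
  imports Defs "HOL-Real_Asymp.Real_Asymp"
begin

text \<open>
  Write \<open>f z = z * exp (L z)\<close>, so that \<open>L = 2 * (\<gamma>\<^sub>1 z + \<gamma>\<^sub>2 z\<^sup>2 + \<dots>)\<close>, and
  \<open>(f z / z) powr (- s) = exp (- s * L z) = \<Sum> c\<^sub>k z\<^sup>k\<close>. For \<open>0 < s < 1/2\<close>, compare the image
  of the annulus \<open>r < |z| < \<rho>\<close> under the injective \<open>f\<close> with the region \<open>|w| \<ge> min\<^bsub>|z|=r\<^esub> |f z|\<close>
  containing it, both measured with the weight \<open>|w| powr (- 2 * s - 2)\<close>; in logarithmic
  coordinates the area of the image is a sum of squares. Letting \<open>r \<rightarrow> 0\<close>,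
  \<open>\<rho> \<rightarrow> 1\<close> gives \<open>\<Sum> (k - s) |c\<^sub>k|\<^sup>2 \<le> 0\<close>. For \<open>s = 1/2\<close> the circumscribed disc is no longer
  asymptotically sharp as \<open>r \<rightarrow> 0\<close>, so this case is reached by a limit in \<open>s\<close>; it is the area
  theorem for the odd function \<open>1 / sqrt (f (z\<^sup>2))\<close> and reads
  \<open>|\<gamma>\<^sub>1|\<^sup>2 + 3 |\<gamma>\<^sub>2 - \<gamma>\<^sub>1\<^sup>2/2|\<^sup>2 + 5 |\<omega>|\<^sup>2 + \<dots> \<le> 1\<close> where \<open>\<omega> = \<gamma>\<^sub>3 - \<gamma>\<^sub>1 \<gamma>\<^sub>2 + \<gamma>\<^sub>1\<^sup>3/6\<close>.
  With \<open>a = |\<gamma>\<^sub>1| \<le> 1\<close> it follows that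
  \<open>|\<gamma>\<^sub>3| - |\<gamma>\<^sub>2| \<le> |\<omega>| + a\<^sup>3/6 \<le> (1 - a\<^sup>2/2) / sqrt 5 + a\<^sup>2/6 \<le> 1 / sqrt 5\<close>.
\<close>

unbundle no fps_syntax

section \<open>Planar integrals\<close>

text \<open>The change of variables theorem is stated for maps of \<open>real^n\<close>, so planar
  integrals are taken over \<open>real^2\<close>; \<open>to_complex\<close> and
  \<open>to_vec\<close> pass to complex notation and back.\<close>

definition to_complex :: "real^2 \<Rightarrow> complex" where
  "to_complex x = Complex (x $ 1) (x $ 2)"

definition to_vec :: "complex \<Rightarrow> real^2" where
  "to_vec z = vector [Re z, Im z]"

lemma to_complex_to_vec [simp]: "to_complex (to_vec z) = z"
  by (simp add: to_complex_def to_vec_def)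

lemma to_vec_to_complex [simp]: "to_vec (to_complex x) = x"
  by (simp add: to_complex_def to_vec_def vec_eq_iff forall_2)

lemma bounded_linear_to_complex: "bounded_linear to_complex"
  by (intro linear_conv_bounded_linear[THEN iffD1] linearI) (auto simp: to_complex_def complex_eq_iff)

lemma bounded_linear_to_vec: "bounded_linear to_vec"
  by (intro linear_conv_bounded_linear[THEN iffD1] linearI) (auto simp: to_vec_def vec_eq_iff forall_2)

text \<open>This is the real Jacobian of a holomorphic map with derivative \<open>d\<close>.\<close>

lemma det_matrix_mult_complex: "det (matrix (\<lambda>u. to_vec (d * to_complex u))) = (cmod d)\<^sup>2"
proof -
  have "det (matrix (\<lambda>u. to_vec (d * to_complex u))) = Re d * Re d + Im d * Im d"
    by (simp add: det_2 matrix_def to_vec_def to_complex_def axis_def)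
  then show ?thesis
    unfolding cmod_power2 by (simp only: power2_eq_square)
qed

text \<open>Needed twice: for \<open>F\<close>, which is \<open>f\<close> in logarithmic
  coordinates, and for \<open>exp\<close>, which gives polar coordinates in the image.\<close>

lemma change_of_variables_holomorphic:
  fixes \<phi> :: "complex \<Rightarrow> real"
  assumes S: "S \<in> sets lebesgue"
    and h: "\<And>x. x \<in> S \<Longrightarrow> (h has_field_derivative h' (to_complex x)) (at (to_complex x))"
    and inj: "inj_on (\<lambda>x. h (to_complex x)) S"
    and int: "(\<lambda>x. (cmod (h' (to_complex x)))\<^sup>2 * \<phi> (h (to_complex x))) absolutely_integrable_on S"
  shows "(\<lambda>x. \<phi> (to_complex x)) absolutely_integrable_on ((\<lambda>x. to_vec (h (to_complex x))) ` S)"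
    and "integral ((\<lambda>x. to_vec (h (to_complex x))) ` S) (\<lambda>x. \<phi> (to_complex x)) =
      integral S (\<lambda>x. (cmod (h' (to_complex x)))\<^sup>2 * \<phi> (h (to_complex x)))"
proof -
  let ?g = "\<lambda>x. to_vec (h (to_complex x))" and ?g' = "\<lambda>x u. to_vec (h' (to_complex x) * to_complex u)"
  \<comment> \<open>The general theorem has vector-valued integrands, so the real function is packed
    into \<open>real^1\<close>.\<close>
  let ?f = "\<lambda>x. vec (\<phi> (to_complex x)) :: real^1"
  have der: "(?g has_derivative ?g' x) (at x within S)" if "x \<in> S" for x
  proof -
    have "((\<lambda>x. h (to_complex x)) has_derivative (\<lambda>u. h' (to_complex x) * to_complex u)) (at x within S)"
      using h[OF that] bounded_linear_to_complex
      by (intro has_derivative_compose[of to_complex to_complex x S h])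
         (auto simp: has_field_derivative_def bounded_linear_imp_has_derivative)
    then show ?thesis
      by (rule bounded_linear.has_derivative[OF bounded_linear_to_vec])
  qed
  have inj': "inj_on ?g S"
    using inj unfolding inj_on_def by (metis to_complex_to_vec)
  have det: "\<bar>det (matrix (?g' x))\<bar> = (cmod (h' (to_complex x)))\<^sup>2" for x
    by (simp add: det_matrix_mult_complex)
  have D: "(\<lambda>x. \<bar>det (matrix (?g' x))\<bar> *\<^sub>R ?f (?g x)) =
      (\<lambda>x. vec ((cmod (h' (to_complex x)))\<^sup>2 * \<phi> (h (to_complex x))))"
    by (simp add: det vec_eq_iff fun_eq_iff)
  \<comment> \<open>An equivalence for every candidate value \<open>b\<close> of the integral;
    taking for \<open>b\<close> the integral over \<open>S\<close> gives both conclusions at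
    once.\<close>
  note * = has_absolute_integral_change_of_variables[OF S der inj', of ?f "vec b" for b,
      unfolded D absolutely_integrable_on_1_iff integral_on_1_eq, simplified]
  let ?b = "integral S (\<lambda>x. (cmod (h' (to_complex x)))\<^sup>2 * \<phi> (h (to_complex x)))"
  have "(\<lambda>x. \<phi> (to_complex x)) absolutely_integrable_on (?g ` S) \<and> integral (?g ` S) (\<lambda>x. \<phi> (to_complex x)) = ?b"
    using *[of ?b] int by (auto simp: vec_eq_iff)
  then show "(\<lambda>x. \<phi> (to_complex x)) absolutely_integrable_on (?g ` S)"
    "integral (?g ` S) (\<lambda>x. \<phi> (to_complex x)) = ?b" by auto
qed

section \<open>Fubini's theorem on rectangles in \<open>real^2\<close>\<close>

lemma bounded_linear_vector_pair:
  "bounded_linear (\<lambda>p :: real \<times> real. vector [fst p, snd p] :: real^2)"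
  by (intro linear_conv_bounded_linear[THEN iffD1] linearI) (auto simp: vec_eq_iff forall_2)

text \<open>The map \<open>g\<close> below is a continuous bijection carrying boxes to boxes of the
  same content, so Fubini on \<open>real \<times> real\<close> transfers.\<close>

lemma integral_cbox_vector:
  fixes k :: "real^2 \<Rightarrow> real"
  assumes k: "continuous_on (cbox (vector [a, c]) (vector [b, d])) k"
  shows "integral (cbox (vector [a, c]) (vector [b, d])) k =
    integral {a..b} (\<lambda>x. integral {c..d} (\<lambda>y. k (vector [x, y])))"
proof -
  define g :: "real \<times> real \<Rightarrow> real^2" where "g = (\<lambda>p. vector [fst p, snd p])"
  define h :: "real^2 \<Rightarrow> real \<times> real" where "h = (\<lambda>x. (x $ 1, x $ 2))"
  have hg: "h (g p) = p" and gh: "g (h x) = x" for p x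
    by (auto simp: g_def h_def vec_eq_iff forall_2)
  have g_cbox: "g ` cbox u v = cbox (g u) (g v)" for u v
  proof -
    have "x \<in> cbox (g u) (g v) \<longleftrightarrow> h x \<in> cbox u v" for x
      by (cases u; cases v) (auto simp: g_def h_def mem_box_cart forall_2 cbox_Pair_eq)
    then show ?thesis
      using imageI[of "h x" "cbox u v" g for x, unfolded gh] hg by (auto simp del: mem_box_cart)
  qed
  have h_cbox: "h ` cbox u v = cbox (h u) (h v)" for u v
  proof -
    have "h ` cbox u v = h ` g ` cbox (h u) (h v)"
      by (simp only: g_cbox gh)
    then show ?thesis
      by (simp only: image_image hg image_ident)
  qed
  have cont: "isCont g p" for p
    unfolding g_def using bounded_linear_vector_pair by (rule linear_continuous_at)
  have ex_2: "(\<exists>i :: 2. P i) \<longleftrightarrow> P 1 \<or> P 2" for P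
    using exhaust_2 by metis
  \<comment> \<open>The factor \<open>1\<close> is the scaling of content that
    \<open>has_integral_twiddle\<close> asks for. The product formula for content holds for nonempty
    boxes, hence the case distinction.\<close>
  have content: "measure lborel (g ` cbox u v) = 1 * measure lborel (cbox u v)" for u v
  proof (cases "fst u \<le> fst v \<and> snd u \<le> snd v")
    case True
    then show ?thesis
      unfolding g_cbox
      by (cases u; cases v) (simp add: g_def content_cbox_if_cart content_Pair interval_eq_empty_cart UNIV_2 ex_2 not_less)
  next
    case False
    then have "cbox u v = {}" "cbox (g u) (g v) = {}"
      by (cases u; cases v; auto simp: g_def interval_eq_empty_cart ex_2 cbox_Pair_eq)+
    then show ?thesis unfolding g_cbox by simp
  qed
  have ex: "\<exists>w z. g ` cbox u v = cbox w z" "\<exists>w z. h ` cbox u' v' = cbox w z" for u v u' v'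
    using g_cbox h_cbox by blast+
  have K: "(k has_integral integral (cbox (g (a, c)) (g (b, d))) k) (cbox (g (a, c)) (g (b, d)))"
    using k by (intro integrable_integral integrable_continuous) (simp add: g_def)
  have "((\<lambda>p. k (g p)) has_integral (1 / 1) *\<^sub>R integral (cbox (g (a, c)) (g (b, d))) k)
      (h ` cbox (g (a, c)) (g (b, d)))"
    by (rule has_integral_twiddle[where g = g and h = h, OF zero_less_one hg gh cont ex content K])
  then have "((\<lambda>p. k (g p)) has_integral integral (cbox (g (a, c)) (g (b, d))) k) (cbox (a, c) (b, d))"
    unfolding h_cbox hg by simp
  moreover have "continuous_on (g ` cbox (a, c) (b, d)) k"
    unfolding g_cbox using k by (simp add: g_def)
  then have "continuous_on (cbox (a, c) (b, d)) (\<lambda>p. k (g p))"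
    by (rule continuous_on_compose2) (auto intro: continuous_at_imp_continuous_on cont)
  ultimately show ?thesis
    using integral_prod_continuous[of a c b d "\<lambda>p. k (g p)"] by (simp add: g_def integral_unique)
qed

text \<open>Turns a bound on each vertical segment into one on the rectangle. In logarithmic
  coordinates the segments are circles, where Bessel's inequality applies.\<close>

lemma integral_cbox_vector_ge:
  fixes k :: "real^2 \<Rightarrow> real"
  assumes k: "continuous_on (cbox (vector [a, c]) (vector [b, d])) k"
    and I: "(u has_integral I) {a..b}"
    and le: "\<And>x. x \<in> {a..b} \<Longrightarrow> u x \<le> integral {c..d} (\<lambda>y. k (vector [x, y]))"
  shows "I \<le> integral (cbox (vector [a, c]) (vector [b, d])) k"
proof -
  have "continuous_on ({a..b} \<times> cbox c d) (\<lambda>(x, y). k (vector [x, y]))"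
    unfolding split_beta
    by (rule continuous_on_compose2[OF k linear_continuous_on[OF bounded_linear_vector_pair]])
       (auto simp: mem_box_cart forall_2)
  then have "continuous_on {a..b} (\<lambda>x. integral (cbox c d) (\<lambda>y. k (vector [x, y])))"
    by (rule integral_continuous_on_param)
  then have "(\<lambda>x. integral {c..d} (\<lambda>y. k (vector [x, y]))) integrable_on {a..b}"
    by (intro integrable_continuous_real) simp
  then have "I \<le> integral {a..b} (\<lambda>x. integral {c..d} (\<lambda>y. k (vector [x, y])))"
    using I le by (intro has_integral_le[OF I]) (auto simp: integrable_integral)
  then show ?thesis using integral_cbox_vector[OF k] by simp
qed

section \<open>Bessel's inequality on circles\<close>

lemma has_integral_cis:
  fixes m :: int
  shows "((\<lambda>t. cis (m * t)) has_integral (if m = 0 then 2 * pi else 0)) {0..2 * pi}"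
proof (cases "m = 0")
  case True
  then show ?thesis using has_integral_const_real[of "1 :: complex" 0 "2 * pi"] by (simp add: scaleR_conv_of_real)
next
  case False
  have "((\<lambda>t. cis (m * t) / (\<i> * m)) has_vector_derivative cis (m * t)) (at t within {0..2 * pi})" for t :: real
  proof -
    have "((\<lambda>z. exp (\<i> * m * z) / (\<i> * m)) has_field_derivative exp (\<i> * m * of_real t)) (at (of_real t))"
      using False by (auto intro!: derivative_eq_intros)
    from has_vector_derivative_real_field[OF this] show ?thesis
      by (simp add: cis_conv_exp mult.assoc)
  qed
  then have "((\<lambda>t. cis (m * t)) has_integral (cis (m * (2 * pi)) / (\<i> * m) - cis (m * (0 :: real)) / (\<i> * m))) {0..2 * pi}"
    by (intro fundamental_theorem_of_calculus) auto
  moreover have "cis (m * (2 * pi)) = 1"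
    using cis_multiple_2pi[of m] by (simp add: mult_ac)
  ultimately show ?thesis using False by simp
qed

text \<open>The squared modulus of \<open>u - T\<close> has nonnegative integral, where
  \<open>T\<close> is the Fourier polynomial of \<open>u\<close>.\<close>

lemma bessel_inequality_cis:
  fixes u :: "real \<Rightarrow> complex" and c :: "nat \<Rightarrow> complex"
  assumes u: "continuous_on {0..2 * pi} u"
    and c: "\<And>k. k \<le> N \<Longrightarrow> ((\<lambda>t. u t * cis (- (k * t))) has_integral 2 * pi * c k) {0..2 * pi}"
  shows "2 * pi * (\<Sum>k\<le>N. (cmod (c k))\<^sup>2) \<le> integral {0..2 * pi} (\<lambda>t. (cmod (u t))\<^sup>2)"
proof -
  define T where "T t = (\<Sum>k\<le>N. c k * cis (k * t))" for t :: real
  define S where "S = 2 * pi * (\<Sum>k\<le>N. (cmod (c k))\<^sup>2)"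
  have cT: "cnj (T t) = (\<Sum>k\<le>N. cnj (c k) * cis (- (k * t)))" for t :: real
    by (simp add: T_def cis_cnj)
  have S: "complex_of_real S = (\<Sum>k\<le>N. cnj (c k) * (2 * pi * c k))"
    by (simp add: S_def sum_distrib_left complex_norm_square mult_ac del: of_real_power)
  \<comment> \<open>Applied to \<open>u\<close> and to \<open>T\<close> itself: they share the
    coefficients up to \<open>N\<close>, so both pairings with \<open>T\<close> equal
    \<open>S\<close>.\<close>
  have pair: "((\<lambda>t. v t * cnj (T t)) has_integral S) {0..2 * pi}"
    if "\<And>k. k \<le> N \<Longrightarrow> ((\<lambda>t. v t * cis (- (k * t))) has_integral 2 * pi * c k) {0..2 * pi}" for v
  proof -
    have "((\<lambda>t. \<Sum>k\<le>N. cnj (c k) * (v t * cis (- (k * t)))) has_integral S) {0..2 * pi}"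
      unfolding S by (intro has_integral_sum has_integral_mult_right that) auto
    moreover have "v t * cnj (T t) = (\<Sum>k\<le>N. cnj (c k) * (v t * cis (- (k * t))))" for t :: real
      unfolding cT sum_distrib_left by (intro sum.cong) (auto simp: mult_ac)
    ultimately show ?thesis by simp
  qed
  have "((\<lambda>t. T t * cis (- (k * t))) has_integral 2 * pi * c k) {0..2 * pi}" if "k \<le> N" for k
  proof -
    have "((\<lambda>t. \<Sum>j\<le>N. c j * cis (of_int (int j - int k) * t)) has_integral
        (\<Sum>j\<le>N. c j * complex_of_real (if int j - int k = 0 then 2 * pi else 0))) {0..2 * pi}"
      by (intro has_integral_sum has_integral_mult_right has_integral_cis) auto
    moreover have "(\<Sum>j\<le>N. c j * complex_of_real (if int j - int k = 0 then 2 * pi else 0)) = 2 * pi * c k"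
      using that by (simp add: if_distrib sum.delta cong: if_cong)
    moreover have "T t * cis (- (k * t)) = (\<Sum>j\<le>N. c j * cis (of_int (int j - int k) * t))" for t :: real
      unfolding T_def sum_distrib_right by (intro sum.cong) (simp_all add: mult.assoc cis_mult algebra_simps)
    ultimately show ?thesis by simp
  qed
  note TT = has_integral_linear[OF pair[OF this] bounded_linear_Re]
    and uT = has_integral_linear[OF pair[OF c] bounded_linear_Re]
  have "(\<lambda>t. (cmod (u t))\<^sup>2) integrable_on {0..2 * pi}"
    using u by (intro integrable_continuous_real continuous_intros)
  then have "((\<lambda>t. (cmod (u t))\<^sup>2 - 2 * (Re \<circ> (\<lambda>t. u t * cnj (T t))) t + (Re \<circ> (\<lambda>t. T t * cnj (T t))) t) has_integral
      integral {0..2 * pi} (\<lambda>t. (cmod (u t))\<^sup>2) - 2 * Re S + Re S) {0..2 * pi}"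
    by (intro has_integral_add has_integral_diff has_integral_mult_right integrable_integral TT uT)
  moreover have "(cmod (u t))\<^sup>2 - 2 * (Re \<circ> (\<lambda>t. u t * cnj (T t))) t + (Re \<circ> (\<lambda>t. T t * cnj (T t))) t =
      (cmod (u t - T t))\<^sup>2" for t
    unfolding cmod_power2 by (simp add: power2_eq_square algebra_simps)
  ultimately have "((\<lambda>t. (cmod (u t - T t))\<^sup>2) has_integral
      integral {0..2 * pi} (\<lambda>t. (cmod (u t))\<^sup>2) - S) {0..2 * pi}"
    by simp
  then have "0 \<le> integral {0..2 * pi} (\<lambda>t. (cmod (u t))\<^sup>2) - S"
    by (rule has_integral_nonneg) auto
  then show ?thesis by (simp add: S_def)
qed

text \<open>By Cauchy's formula the Taylor coefficients times \<open>r ^ k\<close> are the Fourier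
  coefficients of \<open>Q\<close> on the circle of radius \<open>r\<close>.\<close>

lemma bessel_inequality_circle:
  assumes Q: "Q holomorphic_on ball 0 R" and r: "0 < r" "r < R"
  shows "2 * pi * (\<Sum>k\<le>N. (cmod ((deriv ^^ k) Q 0 / fact k))\<^sup>2 * r ^ (2 * k)) \<le>
    integral {0..2 * pi} (\<lambda>t. (cmod (Q (r * cis t)))\<^sup>2)"
proof -
  have cont: "continuous_on (cball 0 r) Q"
    using Q r by (intro holomorphic_on_imp_continuous_on[OF holomorphic_on_subset]) auto
  have hol: "Q holomorphic_on ball 0 r"
    using Q r by (auto elim!: holomorphic_on_subset)
  have contu: "continuous_on {0..2 * pi} (\<lambda>t. Q (r * cis t))"
    using r by (intro continuous_on_compose2[OF cont] continuous_intros) (auto simp: norm_mult)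
  define c where "c k = (deriv ^^ k) Q 0 / fact k * r ^ k" for k
  have "((\<lambda>t. Q (r * cis t) * cis (- (k * t))) has_integral 2 * pi * c k) {0..2 * pi}" for k
  proof -
    \<comment> \<open>The left side has the shape in which the parametrised Cauchy integral with
      centre 0 appears.\<close>
    have eq: "Q (0 + r * cis t) / (0 + r * cis t - 0) ^ Suc k * r * \<i> * cis t =
        \<i> / r ^ k * (Q (r * cis t) * cis (- (k * t)))" for t :: real
    proof -
      have "cis (- (k * t)) = 1 / cis t ^ k"
        by (simp add: Complex.DeMoivre flip: cis_inverse) (simp add: field_simps)
      then show ?thesis using r by (simp add: power_mult_distrib)
    qed
    have "contour_integral (circlepath 0 r) (\<lambda>u. Q u / (u - 0) ^ Suc k) =
        integral {0..2 * pi} (\<lambda>t. \<i> / r ^ k * (Q (r * cis t) * cis (- (k * t))))"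
      unfolding circlepath_def by (subst contour_integral_part_circlepath_eq) (simp_all only: eq pi_gt_zero mult_pos_pos zero_less_numeral of_real_power)
    then have "(deriv ^^ k) Q 0 = fact k / (2 * pi * \<i>) *
        (\<i> / r ^ k * integral {0..2 * pi} (\<lambda>t. Q (r * cis t) * cis (- (k * t))))"
      using Cauchy_higher_derivative_integral_circlepath(2)[OF cont hol, of 0 k] r by simp
    then have "integral {0..2 * pi} (\<lambda>t. Q (r * cis t) * cis (- (k * t))) = 2 * pi * c k"
      using r by (simp add: c_def field_simps)
    moreover have "(\<lambda>t. Q (r * cis t) * cis (- (k * t))) integrable_on {0..2 * pi}"
      by (intro integrable_continuous_real continuous_intros contu)
    ultimately show ?thesis by (simp add: has_integral_iff)
  qed
  from bessel_inequality_cis[OF contu this, of N] show ?thesis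
    using r by (simp add: c_def norm_mult norm_divide norm_power power_mult_distrib power_divide power_even_eq)
qed

section \<open>The weighted area inequality\<close>

text \<open>The Euler operator acts diagonally on power series; the factors \<open>k - s\<close> of
  the area inequality come from here.\<close>

lemma higher_deriv_0_euler:
  assumes P: "P holomorphic_on ball 0 R" "0 < R"
  shows "(deriv ^^ k) (\<lambda>z. z * deriv P z - of_real s * P z) 0 / fact k =
    of_real (real k - s) * ((deriv ^^ k) P 0 / fact k)"
proof -
  define p where "p = fps_expansion P 0"
  have p: "P has_fps_expansion p"
    unfolding p_def using P by (intro has_fps_expansion_fps_expansion[of "ball 0 R"]) auto
  have "(\<lambda>z. z * deriv P z - of_real s * P z) has_fps_expansion
      fps_X * fps_deriv p - fps_const (of_real s) * p"
    by (intro fps_expansion_intros p)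
  from fps_nth_fps_expansion[OF this, of k, symmetric] fps_nth_fps_expansion[OF p, of k, symmetric]
  show ?thesis by (cases k) (auto simp: algebra_simps)
qed

text \<open>By openness of \<open>f\<close>, the image of \<open>ball 0 r\<close> already contains
  the disc of radius \<open>m\<close>, and by injectivity no point outside \<open>ball 0 r\<close>
  can map into it.\<close>

lemma norm_ge_of_inj_on_ball:
  fixes f :: "complex \<Rightarrow> complex"
  assumes f: "f holomorphic_on ball 0 1" "inj_on f (ball 0 1)" "f 0 = 0"
    and r: "0 < r" "r < 1" and m: "0 < m" "\<And>z. cmod z = r \<Longrightarrow> m \<le> cmod (f z)"
    and z: "r \<le> cmod z" "cmod z < 1"
  shows "m \<le> cmod (f z)"
proof (rule ccontr)
  assume "\<not> m \<le> cmod (f z)"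
  then have fz: "f z \<in> ball (f 0) m" by (simp add: f)
  have "ball (f 0) m \<subseteq> f ` ball 0 r"
  proof (rule ball_subset_open_map_image)
    show "continuous_on (closure (ball 0 r)) f"
      using r f(1) by (intro holomorphic_on_imp_continuous_on[OF holomorphic_on_subset[OF f(1)]]) auto
    show "open (f ` interior (ball 0 r))"
      using r f by (intro open_mapping_thm3 holomorphic_on_subset[OF f(1)] inj_on_subset[OF f(2)]) auto
    show "m \<le> cmod (f w - f 0)" if "w \<in> frontier (ball 0 r)" for w
      using that m(2)[of w] r f by simp
  qed (use r m in auto)
  then obtain w where "w \<in> ball 0 r" "f w = f z" using fz by auto
  then have "w = z" using f(2) r z by (auto simp: inj_on_def)
  then show False using \<open>w \<in> ball 0 r\<close> z by simp
qed

lemma has_integral_exp_mult: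
  fixes c :: real
  assumes "c \<noteq> 0" "a \<le> b"
  shows "((\<lambda>x. exp (c * x)) has_integral (exp (c * b) - exp (c * a)) / c) {a..b}"
proof -
  have "((\<lambda>x. exp (c * x) / c) has_vector_derivative exp (c * x)) (at x within {a..b})" for x
    using assms unfolding has_real_derivative_iff_has_vector_derivative[symmetric]
    by (auto intro!: derivative_eq_intros)
  from fundamental_theorem_of_calculus[OF assms(2) this] show ?thesis
    by (simp add: diff_divide_distrib)
qed

text \<open>Up to the factor \<open>pi / s^2\<close>, the weighted area of the image of the annulus
  lies between the two sides. Every summand is nonnegative, also for \<open>k = 0\<close>, so
  truncation at \<open>N\<close> goes in the right direction.\<close>

lemma weighted_area_inequality:
  fixes L :: "complex \<Rightarrow> complex" and s r \<rho> m :: real and N :: nat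
  defines "f \<equiv> \<lambda>z. z * exp (L z)"
    and "c \<equiv> \<lambda>k. (deriv ^^ k) (\<lambda>z. exp (- s * L z)) 0 / fact k"
  assumes L: "L holomorphic_on ball 0 1" and inj: "inj_on f (ball 0 1)"
    and s: "0 < s" "s < 1" and r: "0 < r" "r < \<rho>" "\<rho> < 1"
    and m: "0 < m" "\<And>z. cmod z = r \<Longrightarrow> m \<le> cmod (f z)"
  shows "(\<Sum>k\<le>N. (k - s) * (cmod (c k))\<^sup>2 * (\<rho> powr (2 * (k - s)) - r powr (2 * (k - s)))) \<le>
    s * m powr (-2 * s)"
proof -
  define P where "P = (\<lambda>z. exp (- s * L z))"
  \<comment> \<open>\<open>exp (-s * \<zeta>) * P (exp \<zeta>)\<close> is \<open>F \<zeta>\<close>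
    to the power \<open>-s\<close>, and its derivative is
    \<open>exp (-s * \<zeta>) * Q (exp \<zeta>)\<close>.\<close>
  define Q where "Q = (\<lambda>z. z * deriv P z - of_real s * P z)"
  define q where "q k = (deriv ^^ k) Q 0 / fact k" for k
  define F where "F = (\<lambda>\<zeta>. f (exp \<zeta>))"
  define F' where "F' = (\<lambda>\<zeta>. F \<zeta> * (1 + exp \<zeta> * deriv L (exp \<zeta>)))"
  \<comment> \<open>Up to the factor \<open>s^2\<close>, this is the area density pulled back along
    the power map with exponent \<open>-s\<close>.\<close>
  define \<phi> where "\<phi> w = cmod w powr (-2 * s - 2)" for w
  define a b where "a = ln r" and "b = ln \<rho>"
  have ab: "a < b" "b < 0" "exp a = r" "exp b = \<rho>"
    using r by (auto simp: a_def b_def)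
  have P: "P holomorphic_on ball 0 1"
    unfolding P_def by (intro holomorphic_intros L)
  have Q: "Q holomorphic_on ball 0 1"
    unfolding Q_def by (intro holomorphic_intros P) auto
  have dL: "(L has_field_derivative deriv L z) (at z)" if "cmod z < 1" for z
    using L that by (intro holomorphic_derivI[of _ "ball 0 1"]) auto
  have Q_eq: "Q z = - s * P z * (1 + z * deriv L z)" if "cmod z < 1" for z
  proof -
    have "(P has_field_derivative - s * deriv L z * P z) (at z)"
      unfolding P_def using dL[OF that] by (auto intro!: derivative_eq_intros)
    then show ?thesis by (simp add: Q_def DERIV_imp_deriv algebra_simps)
  qed
  have q: "q k = of_real (k - s) * c k" for k
    unfolding q_def Q_def c_def using higher_deriv_0_euler[OF P] by (simp add: P_def)
  have F: "(F has_field_derivative F' \<zeta>) (at \<zeta>)" if "Re \<zeta> < 0" for \<zeta>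
  proof -
    have "cmod (exp \<zeta>) < 1" using that by simp
    then show ?thesis unfolding F_def f_def F'_def
      by (auto intro!: derivative_eq_intros DERIV_chain2[OF dL] simp: algebra_simps)
  qed
  have hol_f: "f holomorphic_on ball 0 1" unfolding f_def by (intro holomorphic_intros L)

  \<comment> \<open>The weight pulled back along \<open>F\<close>. The box from \<open>A\<close> to
    \<open>B\<close> is the annulus in logarithmic coordinates, cut along the positive real
    axis.\<close>
  define k where "k = (\<lambda>x. (cmod (F' (to_complex x)))\<^sup>2 * \<phi> (F (to_complex x)))"
  define A B where "A = (vector [a, 0] :: real^2)" and "B = (vector [b, 2 * pi] :: real^2)"
  have k_eq: "k x = exp (-2 * s * Re (to_complex x)) * (cmod (Q (exp (to_complex x))))\<^sup>2 / s\<^sup>2" if "Re (to_complex x) < 0" for x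
  proof -
    define z where "z = exp (to_complex x)"
    have z: "cmod z < 1" "cmod z = exp (Re (to_complex x))" using that by (auto simp: z_def)
    have F: "cmod (F (to_complex x)) = exp (Re (to_complex x) + Re (L z))"
      unfolding F_def f_def z_def[symmetric] by (simp add: norm_mult z exp_add)
    have P: "cmod (P z) = exp (- s * Re (L z))" by (simp add: P_def)
    have "(cmod (F (to_complex x)))\<^sup>2 * \<phi> (F (to_complex x)) = exp (-2 * s * Re (to_complex x)) * (cmod (P z))\<^sup>2"
      unfolding \<phi>_def F P powr_def
      by (simp flip: exp_add exp_of_nat_mult) (simp add: algebra_simps)
    moreover have "k x = (cmod (F (to_complex x)))\<^sup>2 * \<phi> (F (to_complex x)) * (cmod (1 + z * deriv L z))\<^sup>2"
      by (simp add: k_def F'_def z_def norm_mult power_mult_distrib)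
    moreover have "(cmod (Q z))\<^sup>2 = s\<^sup>2 * (cmod (P z))\<^sup>2 * (cmod (1 + z * deriv L z))\<^sup>2"
      unfolding Q_eq[OF z(1)] by (simp add: norm_mult power_mult_distrib)
    ultimately show ?thesis using s by (simp flip: z_def)
  qed
  have Re_Im_to_complex: "Re (to_complex x) = x $ 1" "Im (to_complex x) = x $ 2" for x by (auto simp: to_complex_def)
  have inAB: "x \<in> cbox A B \<longleftrightarrow> a \<le> x $ 1 \<and> x $ 1 \<le> b \<and> 0 \<le> x $ 2 \<and> x $ 2 \<le> 2 * pi"
    "x \<in> box A B \<longleftrightarrow> a < x $ 1 \<and> x $ 1 < b \<and> 0 < x $ 2 \<and> x $ 2 < 2 * pi" for x
    by (auto simp: A_def B_def mem_box_cart forall_2)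
  have cont_to_complex: "continuous_on X to_complex" for X
    using bounded_linear_to_complex by (rule linear_continuous_on)
  have cont_Q: "continuous_on (ball 0 1) Q" using Q by (rule holomorphic_on_imp_continuous_on)
  have "continuous_on (cbox A B) (\<lambda>x. exp (-2 * s * Re (to_complex x)) * (cmod (Q (exp (to_complex x))))\<^sup>2 / s\<^sup>2)"
    using s ab by (intro continuous_intros cont_to_complex continuous_on_compose2[OF cont_Q]) (auto simp: inAB Re_Im_to_complex)
  then have cont_k: "continuous_on (cbox A B) k"
    using ab by (subst continuous_on_cong[OF refl k_eq]) (auto simp: inAB Re_Im_to_complex)

  \<comment> \<open>Bessel's inequality for \<open>Q\<close> on each circle of radius
    \<open>exp x\<close>, integrated over \<open>x\<close>.\<close>
  have lower: "(\<Sum>j\<le>N. 2 * pi / s\<^sup>2 * (cmod (q j))\<^sup>2 *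
      ((exp (2 * (j - s) * b) - exp (2 * (j - s) * a)) / (2 * (j - s)))) \<le> integral (cbox A B) k"
    unfolding A_def B_def
  proof (rule integral_cbox_vector_ge)
    show "continuous_on (cbox (vector [a, 0]) (vector [b, 2 * pi])) k"
      using cont_k by (simp add: A_def B_def)
    show "((\<lambda>x. \<Sum>j\<le>N. 2 * pi / s\<^sup>2 * (cmod (q j))\<^sup>2 * exp (2 * (j - s) * x)) has_integral
      (\<Sum>j\<le>N. 2 * pi / s\<^sup>2 * (cmod (q j))\<^sup>2 *
      ((exp (2 * (j - s) * b) - exp (2 * (j - s) * a)) / (2 * (j - s))))) {a..b}"
    proof (intro has_integral_sum has_integral_mult_right has_integral_exp_mult)
      \<comment> \<open>For \<open>j = 0\<close> the value is \<open>-2 * s\<close>; for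
        \<open>j \<ge> 1\<close> it is positive because \<open>s < 1\<close>.\<close>
      show "2 * (real j - s) \<noteq> 0" for j using s by (cases j) auto
    qed (use ab in auto)
    show "(\<Sum>j\<le>N. 2 * pi / s\<^sup>2 * (cmod (q j))\<^sup>2 * exp (2 * (j - s) * x)) \<le>
        integral {0..2 * pi} (\<lambda>y. k (vector [x, y]))" if x: "x \<in> {a..b}" for x
    proof -
      have "k (vector [x, y]) = exp (-2 * s * x) / s\<^sup>2 * (cmod (Q (exp x * cis y)))\<^sup>2" for y
        using k_eq[of "vector [x, y]"] x ab by (simp add: to_complex_def exp_eq_polar)
      moreover have "2 * pi * (\<Sum>j\<le>N. (cmod (q j))\<^sup>2 * exp x ^ (2 * j)) \<le>
          integral {0..2 * pi} (\<lambda>y. (cmod (Q (exp x * cis y)))\<^sup>2)"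
        using bessel_inequality_circle[OF Q, of "exp x" N] x ab by (simp add: q_def flip: exp_of_real)
      then have "exp (-2 * s * x) / s\<^sup>2 * (2 * pi * (\<Sum>j\<le>N. (cmod (q j))\<^sup>2 * exp x ^ (2 * j))) \<le>
          exp (-2 * s * x) / s\<^sup>2 * integral {0..2 * pi} (\<lambda>y. (cmod (Q (exp x * cis y)))\<^sup>2)"
        by (intro mult_left_mono) auto
      moreover have "exp (2 * (j - s) * x) = exp (-2 * s * x) * exp x ^ (2 * j)" for j :: nat
        by (simp add: algebra_simps flip: exp_add exp_of_nat_mult)
      ultimately show ?thesis by (simp add: sum_distrib_left mult_ac)
    qed
  qed

  \<comment> \<open>An outer radius makes the comparison region a bounded annulus; it drops out of
    the final estimate.\<close>
  obtain M where M: "\<And>z. cmod z \<le> \<rho> \<Longrightarrow> cmod (f z) \<le> M" "m \<le> M"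
  proof -
    have "compact (f ` cball 0 \<rho>)"
      using r by (intro compact_continuous_image holomorphic_on_imp_continuous_on
          holomorphic_on_subset[OF hol_f]) auto
    then obtain M where M: "\<And>z. cmod z \<le> \<rho> \<Longrightarrow> cmod (f z) \<le> M"
      using compact_imp_bounded by (force simp: bounded_iff)
    moreover have "m \<le> M" using m(2)[of "of_real r"] M[of "of_real r"] r by auto
    ultimately show ?thesis using that by blast
  qed
  define A' B' where "A' = (vector [ln m, 0] :: real^2)" and "B' = (vector [ln M, 2 * pi] :: real^2)"
  \<comment> \<open>The edge at angle \<open>2 * pi\<close> is removed to make \<open>exp\<close>
    injective.\<close>
  define S where "S = {x \<in> cbox A' B'. x $ 2 \<noteq> 2 * pi}"
  have inAB': "x \<in> cbox A' B' \<longleftrightarrow> ln m \<le> x $ 1 \<and> x $ 1 \<le> ln M \<and> 0 \<le> x $ 2 \<and> x $ 2 \<le> 2 * pi" for x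
    by (auto simp: A'_def B'_def mem_box_cart forall_2)
  have S: "S \<in> sets lebesgue"
  proof -
    have "S = cbox A' B' - {x. x $ 2 = 2 * pi}" by (auto simp: S_def)
    moreover have "closed {x :: real^2. x $ 2 = 2 * pi}"
      by (intro closed_Collect_eq continuous_intros)
    ultimately show ?thesis by auto
  qed
  define e where "e x = exp (-2 * s * (x $ 1))" for x :: "real^2"
  have e_eq: "(cmod (exp (to_complex x)))\<^sup>2 * \<phi> (exp (to_complex x)) = e x" for x
    by (simp add: \<phi>_def e_def Re_Im_to_complex powr_def flip: exp_add exp_of_nat_mult) (simp add: algebra_simps)
  have cont_e: "continuous_on X e" for X unfolding e_def by (intro continuous_intros)
  have "e absolutely_integrable_on cbox A' B'"
    by (intro absolutely_integrable_continuous cont_e)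
  then have e_int: "e absolutely_integrable_on S"
    by (rule set_integrable_subset) (use S in \<open>auto simp: S_def\<close>)
  have exp_inj: "inj_on (\<lambda>x. exp (to_complex x)) {x. 0 \<le> x $ 2 \<and> x $ 2 < 2 * pi}"
  proof (rule inj_onI)
    fix x y :: "real^2" assume xy: "x \<in> {x. 0 \<le> x $ 2 \<and> x $ 2 < 2 * pi}" "y \<in> {x. 0 \<le> x $ 2 \<and> x $ 2 < 2 * pi}"
      and eq: "exp (to_complex x) = exp (to_complex y)"
    have "\<bar>Im (to_complex x) - Im (to_complex y)\<bar> < 2 * pi"
      using xy unfolding Re_Im_to_complex by (simp add: abs_less_iff)
    then have "to_complex x = to_complex y"
      using eq by (rule exp_complex_eqI)
    then show "x = y" by (metis to_vec_to_complex)
  qed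
  have "inj_on (\<lambda>x. exp (to_complex x)) S"
    by (rule inj_on_subset[OF exp_inj]) (auto simp: S_def inAB')
  note cov_exp = change_of_variables_holomorphic[OF S DERIV_exp this, of \<phi>, unfolded e_eq, OF e_int]

  have "k absolutely_integrable_on cbox A B" using cont_k by (rule absolutely_integrable_continuous)
  \<comment> \<open>On the open box the identified edges at angles 0 and \<open>2 * pi\<close> are
    absent, so \<open>F\<close> is injective there.\<close>
  then have k_int: "k absolutely_integrable_on box A B"
    by (rule set_integrable_subset) (auto simp: box_subset_cbox)
  have F_inj: "inj_on (\<lambda>x. F (to_complex x)) (box A B)"
  proof (rule inj_onI)
    fix x y :: "real^2"
    assume xy: "x \<in> box A B" "y \<in> box A B" and eq: "F (to_complex x) = F (to_complex y)"
    have "exp (to_complex x) = exp (to_complex y)"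
    proof (rule inj_onD[OF inj])
      show "f (exp (to_complex x)) = f (exp (to_complex y))" using eq by (simp add: F_def)
      show "exp (to_complex x) \<in> ball 0 1" "exp (to_complex y) \<in> ball 0 1"
        using xy ab by (simp_all add: inAB Re_Im_to_complex)
    qed
    then show "x = y"
      by (rule inj_onD[OF exp_inj]) (use xy in \<open>simp_all add: inAB\<close>)
  qed
  have F_der: "(F has_field_derivative F' (to_complex x)) (at (to_complex x))" if "x \<in> box A B" for x
    using that ab by (intro F) (simp add: inAB Re_Im_to_complex)
  note cov_F = change_of_variables_holomorphic[OF _ F_der F_inj k_int[unfolded k_def], folded k_def, simplified]
  have sub: "(\<lambda>x. to_vec (F (to_complex x))) ` box A B \<subseteq> (\<lambda>x. to_vec (exp (to_complex x))) ` S"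
  proof safe
    fix x :: "real^2" assume x: "x \<in> box A B"
    define w where "w = F (to_complex x)"
    have z: "r \<le> cmod (exp (to_complex x))" "cmod (exp (to_complex x)) \<le> \<rho>"
      using x ab by (auto simp: inAB Re_Im_to_complex simp flip: ab(3,4))
    have w: "m \<le> cmod w" "cmod w \<le> M"
    proof -
      have "r < 1" "cmod (exp (to_complex x)) < 1" "f 0 = 0"
        using r le_less_trans[OF z(2) r(3)] by (simp_all add: f_def)
      then show "m \<le> cmod w"
        unfolding w_def F_def by (intro norm_ge_of_inj_on_ball[OF hol_f inj _ r(1) _ m z(1)])
      show "cmod w \<le> M" unfolding w_def F_def by (rule M(1)[OF z(2)])
    qed
    have "0 < cmod w" using w(1) m(1) by linarith
    \<comment> \<open>The logarithm of \<open>w\<close> with argument in \<open>[0, 2 * pi)\<close>,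
      which places it in \<open>S\<close>.\<close>
    define y where "y = to_vec (Complex (ln (cmod w)) (Arg2pi w))"
    have "exp (to_complex y) = of_real (cmod w) * cis (Arg2pi w)"
      using \<open>0 < cmod w\<close> by (simp add: y_def exp_eq_polar)
    then have "exp (to_complex y) = w"
      by (simp only: cis_conv_exp Arg2pi_eq[symmetric])
    moreover have "ln m \<le> ln (cmod w)" "ln (cmod w) \<le> ln M"
      using w m(1) \<open>0 < cmod w\<close> by simp_all
    then have "y \<in> S"
      using Arg2pi_ge_0[of w] Arg2pi_lt_2pi[of w] by (simp add: S_def inAB' y_def to_vec_def)
    ultimately show "to_vec (F (to_complex x)) \<in> (\<lambda>x. to_vec (exp (to_complex x))) ` S"
      by (intro image_eqI[of _ _ y]) (simp_all add: w_def)
  qed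
  have "integral (cbox A B) k = integral (box A B) k"
    by (rule integral_open_interval[symmetric])
  \<comment> \<open>Both integrals are rewritten as integrals of \<open>\<phi>\<close> over the
    images, where nonnegativity and \<open>sub\<close> give monotonicity.\<close>
  also have "\<dots> \<le> integral S e"
    unfolding cov_F(2)[symmetric] cov_exp(2)[symmetric]
    by (rule integral_subset_le[OF sub cov_F(1)[THEN set_lebesgue_integral_eq_integral(1)]
          cov_exp(1)[THEN set_lebesgue_integral_eq_integral(1)]]) (simp add: \<phi>_def)
  also have "\<dots> \<le> integral (cbox A' B') e"
    by (rule integral_subset_le[OF _ e_int[THEN set_lebesgue_integral_eq_integral(1)]
          integrable_continuous[OF cont_e]]) (auto simp: S_def e_def)
  also have "\<dots> = integral {ln m..ln M} (\<lambda>x. 2 * pi * exp (-2 * s * x))"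
    unfolding A'_def B'_def by (subst integral_cbox_vector[OF cont_e]) (simp add: e_def)
  also have "\<dots> = 2 * pi * ((exp (-2 * s * ln M) - exp (-2 * s * ln m)) / (-2 * s))"
    using s m M by (intro integral_unique has_integral_mult_right has_integral_exp_mult) auto
  \<comment> \<open>The contribution of \<open>M\<close> is negative and is discarded.\<close>
  also have "\<dots> \<le> pi / s * m powr (-2 * s)"
    using s m M by (simp add: powr_def field_simps)
  finally have "(\<Sum>j\<le>N. 2 * pi / s\<^sup>2 * (cmod (q j))\<^sup>2 *
      ((exp (2 * (j - s) * b) - exp (2 * (j - s) * a)) / (2 * (j - s)))) \<le> pi / s * m powr (-2 * s)"
    using lower by simp
  \<comment> \<open>The coefficient of \<open>Q\<close> supplies \<open>(j - s)^2\<close>, and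
    integrating the exponential cancels one factor.\<close>
  moreover have "2 * pi / s\<^sup>2 * (cmod (q j))\<^sup>2 *
      ((exp (2 * (j - s) * b) - exp (2 * (j - s) * a)) / (2 * (j - s))) =
      pi / s\<^sup>2 * ((j - s) * (cmod (c j))\<^sup>2 * (\<rho> powr (2 * (j - s)) - r powr (2 * (j - s))))" for j
  proof -
    have "real j - s \<noteq> 0" using s by (cases j) auto
    moreover have "2 * pi / s\<^sup>2 * (d\<^sup>2 * C) * (E / (2 * d)) = pi / s\<^sup>2 * (d * C * E)" if "d \<noteq> 0" for d C E :: real
      using that by (simp add: power2_eq_square)
    moreover have "(cmod (q j))\<^sup>2 = (j - s)\<^sup>2 * (cmod (c j))\<^sup>2"
      by (simp only: q norm_mult norm_of_real power_mult_distrib power2_abs)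
    moreover have "\<rho> powr x = exp (x * b)" "r powr x = exp (x * a)" for x
      using r by (simp_all add: powr_def a_def b_def)
    ultimately show ?thesis by metis
  qed
  ultimately have "pi / s\<^sup>2 * (\<Sum>j\<le>N. (j - s) * (cmod (c j))\<^sup>2 *
      (\<rho> powr (2 * (j - s)) - r powr (2 * (j - s)))) \<le> pi / s\<^sup>2 * (s * m powr (-2 * s))"
    using s by (simp add: sum_distrib_left power2_eq_square)
  then show ?thesis
    using s by (subst (asm) mult_le_cancel_left_pos) auto
qed

text \<open>As \<open>r\<close> tends to 0, the term \<open>k = 0\<close> and the right side of the
  weighted inequality both grow like \<open>s * r powr (-2 * s)\<close>. Their difference is of
  order \<open>r powr (1 - 2 * s)\<close>, which vanishes in the limit because
  \<open>s < 1 / 2\<close>.\<close>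

lemma area_inequality_exponent_lt_half:
  fixes L :: "complex \<Rightarrow> complex" and s :: real and N :: nat
  defines "c \<equiv> \<lambda>k. (deriv ^^ k) (\<lambda>z. exp (- s * L z)) 0 / fact k"
  assumes L: "L holomorphic_on ball 0 1" "L 0 = 0" and inj: "inj_on (\<lambda>z. z * exp (L z)) (ball 0 1)"
    and s: "0 < s" "s < 1 / 2"
  shows "(\<Sum>k\<le>N. (k - s) * (cmod (c k))\<^sup>2) \<le> 0"
proof -
  have c0: "c 0 = 1" by (simp add: c_def L)
  have "(L has_field_derivative deriv L 0) (at 0)"
    using L by (intro holomorphic_derivI[of _ "ball 0 1"]) auto
  then have "((\<lambda>z. L z / z) \<longlongrightarrow> deriv L 0) (at 0)"
    by (simp add: has_field_derivative_iff L)
  then have "eventually (\<lambda>z. cmod (L z / z) < cmod (deriv L 0) + 1) (at 0)"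
    by (intro order_tendstoD[OF tendsto_norm]) auto
  then obtain \<delta> where \<delta>: "\<delta> > 0" "\<And>z. z \<noteq> 0 \<Longrightarrow> cmod z < \<delta> \<Longrightarrow> cmod (L z / z) < cmod (deriv L 0) + 1"
    unfolding eventually_at by auto
  \<comment> \<open>Near 0 this gives \<open>cmod (L z) \<le> C * cmod z\<close>, hence the lower
    bound \<open>r * exp (- C * r)\<close> for \<open>f\<close> on the circle.\<close>
  define C where "C = cmod (deriv L 0) + 1"
  \<comment> \<open>All terms depending on \<open>r\<close>; the last is
    \<open>s * (m powr (-2 * s) - r powr (-2 * s))\<close>, written with a difference quotient whose
    limit is known.\<close>
  define h where "h r = (\<Sum>k = 1..N. (k - s) * (cmod (c k))\<^sup>2 * r powr (2 * (k - s))) +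
    s * ((exp (2 * s * C * r) - 1) / r * r powr (1 - 2 * s))" for r :: real
  have bound: "(\<Sum>k\<le>N. (k - s) * (cmod (c k))\<^sup>2 * \<rho> powr (2 * (k - s))) \<le> h r"
    if \<rho>: "\<rho> < 1" and r: "0 < r" "r < \<rho>" "r < \<delta>" for r \<rho>
  proof -
    define m where "m = r * exp (- C * r)"
    have "m \<le> cmod (z * exp (L z))" if z: "cmod z = r" for z
    proof -
      have "cmod (L z / z) < C" "z \<noteq> 0" using \<delta>(2)[of z] z r by (auto simp: C_def)
      then have "cmod (L z) \<le> C * r" using z r by (simp add: norm_divide field_simps)
      then have "- C * r \<le> Re (L z)" using abs_Re_le_cmod[of "L z"] by simp
      then show ?thesis using z r by (simp add: m_def norm_mult)
    qed
    then have *: "(\<Sum>k\<le>N. (k - s) * (cmod (c k))\<^sup>2 * (\<rho> powr (2 * (k - s)) - r powr (2 * (k - s)))) \<le>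
        s * m powr (-2 * s)"
      unfolding c_def using r \<rho> s
      by (intro weighted_area_inequality[OF L(1) inj]) (auto simp: m_def)
    have "m powr (-2 * s) = r powr (-2 * s) * exp (2 * s * C * r)"
      using r by (simp add: m_def powr_def ln_mult exp_add[symmetric] algebra_simps)
    moreover have "r powr (1 - 2 * s) = r * r powr (-2 * s)"
      using r powr_add[of r 1 "-2 * s"] by simp
    ultimately have "s * m powr (-2 * s) = s * ((exp (2 * s * C * r) - 1) / r * r powr (1 - 2 * s)) + s * r powr (-2 * s)"
      using r by (simp add: field_simps)
    \<comment> \<open>The divergent term \<open>k = 0\<close> is split off; its coefficient is
      \<open>c 0 = 1\<close>.\<close>
    moreover have "(\<Sum>k\<le>N. (k - s) * (cmod (c k))\<^sup>2 * r powr (2 * (k - s))) =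
        (\<Sum>k = 1..N. (k - s) * (cmod (c k))\<^sup>2 * r powr (2 * (k - s))) - s * r powr (-2 * s)"
      unfolding atMost_atLeast0 by (subst sum.atLeast_Suc_atMost) (auto simp: c0)
    ultimately show ?thesis
      using * by (simp add: h_def right_diff_distrib sum_subtractf)
  qed
  have h: "(h \<longlongrightarrow> 0) (at_right 0)"
  proof -
    have pw: "((\<lambda>r :: real. r powr e) \<longlongrightarrow> 0) (at_right 0)" if "e > 0" for e
      using that by real_asymp
    have "((\<lambda>r. exp (2 * s * C * r)) has_real_derivative 2 * s * C) (at 0)"
      by (auto intro!: derivative_eq_intros)
    then have "((\<lambda>r. (exp (2 * s * C * r) - 1) / r) \<longlongrightarrow> 2 * s * C) (at 0)"
      by (simp add: has_field_derivative_iff)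
    then have "((\<lambda>r. (exp (2 * s * C * r) - 1) / r) \<longlongrightarrow> 2 * s * C) (at_right 0)"
      by (rule tendsto_mono[rotated]) (simp add: at_le)
    then have "(h \<longlongrightarrow> (\<Sum>k = 1..N. (k - s) * (cmod (c k))\<^sup>2 * 0) + s * (2 * s * C * 0)) (at_right 0)"
      unfolding h_def using s
      by (intro tendsto_intros pw) auto
    then show ?thesis by simp
  qed
  \<comment> \<open>First \<open>r\<close> tends to 0 with \<open>\<rho>\<close> fixed, then
    \<open>\<rho>\<close> tends to 1.\<close>
  have "(\<Sum>k\<le>N. (k - s) * (cmod (c k))\<^sup>2 * \<rho> powr (2 * (k - s))) \<le> 0" if "0 < \<rho>" "\<rho> < 1" for \<rho>
  proof (rule tendsto_lowerbound[OF h])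
    have "eventually (\<lambda>r :: real. 0 < r \<and> r < min \<rho> \<delta>) (at_right 0)"
      using that \<delta>(1) eventually_at_right_real[of 0 "min \<rho> \<delta>"] by (auto elim!: eventually_mono)
    then show "eventually (\<lambda>r. (\<Sum>k\<le>N. (k - s) * (cmod (c k))\<^sup>2 * \<rho> powr (2 * (k - s))) \<le> h r) (at_right 0)"
      by (rule eventually_mono, intro bound) (use that in auto)
  qed auto
  moreover have "eventually (\<lambda>\<rho> :: real. 0 < \<rho> \<and> \<rho> < 1) (at_left 1)"
    using eventually_at_left_real[of 0 "1 :: real"] by (auto elim!: eventually_mono)
  ultimately have "eventually (\<lambda>\<rho>. (\<Sum>k\<le>N. (k - s) * (cmod (c k))\<^sup>2 * \<rho> powr (2 * (k - s))) \<le> 0) (at_left 1)"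
    by (auto elim!: eventually_mono)
  moreover have "((\<lambda>\<rho>. \<Sum>k\<le>N. (k - s) * (cmod (c k))\<^sup>2 * \<rho> powr (2 * (k - s))) \<longlongrightarrow>
      (\<Sum>k\<le>N. (k - s) * (cmod (c k))\<^sup>2 * 1 powr (2 * (k - s)))) (at_left 1)"
    by (intro tendsto_intros) auto
  ultimately show ?thesis
    by (auto dest: tendsto_upperbound)
qed

section \<open>Logarithmic coefficients\<close>

text \<open>Compare coefficients in \<open>P' = t * L' * P\<close> for
  \<open>P = exp (t * L)\<close>.\<close>

lemma exp_coeffs_recurrence:
  fixes t :: real
  assumes L: "L holomorphic_on ball 0 R" "0 < R" "L 0 = 0"
  defines "l \<equiv> \<lambda>k. (deriv ^^ k) L 0 / fact k"
    and "c \<equiv> \<lambda>k. (deriv ^^ k) (\<lambda>z. exp (of_real t * L z)) 0 / fact k"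
  shows "c 0 = 1"
    and "of_nat (Suc n) * c (Suc n) = of_real t * (\<Sum>i\<le>n. of_nat (Suc i) * l (Suc i) * c (n - i))"
proof -
  define P where "P = (\<lambda>z. exp (of_real t * L z))"
  have "P holomorphic_on ball 0 R"
    unfolding P_def by (intro holomorphic_intros L)
  then have p: "P has_fps_expansion fps_expansion P 0"
    using L(2) by (intro has_fps_expansion_fps_expansion[of "ball 0 R"]) auto
  have l: "L has_fps_expansion fps_expansion L 0"
    using L by (intro has_fps_expansion_fps_expansion[of "ball 0 R"]) auto
  define G where "G = fps_const (of_real t) * (fps_deriv (fps_expansion L 0) * fps_expansion P 0)"
  have "(\<lambda>z. of_real t * (deriv L z * P z)) has_fps_expansion G"
    unfolding G_def by (intro fps_expansion_intros p l)
  moreover have "eventually (\<lambda>z. deriv P z = of_real t * (deriv L z * P z)) (nhds 0)"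
  proof -
    have "deriv P z = of_real t * (deriv L z * P z)" if "z \<in> ball 0 R" for z
    proof -
      have "(L has_field_derivative deriv L z) (at z)"
        using L that by (intro holomorphic_derivI[of _ "ball 0 R"]) auto
      then show ?thesis unfolding P_def
        by (intro DERIV_imp_deriv) (auto intro!: derivative_eq_intros)
    qed
    then show ?thesis
      using L(2) by (intro eventually_nhds_in_open[THEN eventually_mono, of "ball 0 R"]) auto
  qed
  ultimately have "deriv P has_fps_expansion G"
    by (subst has_fps_expansion_cong[OF _ refl]) auto
  from fps_nth_fps_expansion[OF this, of n] fps_nth_fps_expansion[OF has_fps_expansion_deriv[OF p], of n]
  have "fps_nth (fps_deriv (fps_expansion P 0)) n = fps_nth G n" by simp
  then have "of_nat (Suc n) * fps_nth (fps_expansion P 0) (Suc n) = of_real t *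
      (\<Sum>i\<le>n. of_nat (Suc i) * fps_nth (fps_expansion L 0) (Suc i) * fps_nth (fps_expansion P 0) (n - i))"
    unfolding G_def fps_mult_left_const_nth unfolding fps_mult_nth fps_deriv_nth atLeast0AtMost by simp
  then show "of_nat (Suc n) * c (Suc n) = of_real t * (\<Sum>i\<le>n. of_nat (Suc i) * l (Suc i) * c (n - i))"
    unfolding fps_expansion_def fps_nth_Abs_fps c_def l_def P_def .
  show "c 0 = 1" by (simp add: c_def L(3))
qed

lemma exp_coeffs_upto_3:
  fixes s :: real
  assumes L: "L holomorphic_on ball 0 R" "0 < R" "L 0 = 0"
  defines "g \<equiv> \<lambda>k. (deriv ^^ k) L 0 / (2 * fact k)"
    and "c \<equiv> \<lambda>k. (deriv ^^ k) (\<lambda>z. exp (- of_real s * L z)) 0 / fact k"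
  shows "c 0 = 1" "c 1 = - 2 * of_real s * g 1"
    "c 2 = - 2 * of_real s * g 2 + 2 * of_real s ^ 2 * g 1 ^ 2"
    "c 3 = - 2 * of_real s * g 3 + 4 * of_real s ^ 2 * g 1 * g 2 - 4 / 3 * of_real s ^ 3 * g 1 ^ 3"
proof -
  define l where "l k = 2 * g k" for k
  note * = exp_coeffs_recurrence[OF L, where t = "- s", unfolded of_real_minus]
  show c0: "c 0 = 1" using *(1) by (simp add: c_def)
  have rec: "of_nat (Suc n) * c (Suc n) = - of_real s * (\<Sum>i\<le>n. of_nat (Suc i) * l (Suc i) * c (n - i))" for n
    using *(2)[of n] by (simp add: c_def l_def g_def del: of_nat_Suc fact_Suc)
  show c1: "c 1 = - 2 * of_real s * g 1"
    using rec[of 0] by (simp add: c0 l_def)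
  have "2 * c 2 = - of_real s * (l 1 * c 1 + 2 * l 2)"
    using rec[of 1] by (simp add: c0 numeral_2_eq_2)
  then show c2: "c 2 = - 2 * of_real s * g 2 + 2 * of_real s ^ 2 * g 1 ^ 2"
    unfolding c1 l_def by algebra
  have "3 * c 3 = - of_real s * (l 1 * c 2 + 2 * l 2 * c 1 + 3 * l 3)"
    using rec[of 2] by (simp add: c0 numeral_2_eq_2 numeral_3_eq_3)
  then show "c 3 = - 2 * of_real s * g 3 + 4 * of_real s ^ 2 * g 1 * g 2 - 4 / 3 * of_real s ^ 3 * g 1 ^ 3"
    unfolding c1 c2 l_def by (simp add: field_simps) algebra
qed

text \<open>The partial sum up to \<open>k = 3\<close> is continuous in \<open>s\<close>, so it
  stays nonpositive at \<open>s = 1 / 2\<close>. There the weights are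
  \<open>-1/2, 1/2, 3/2, 5/2\<close>, and doubling gives the claim.\<close>

lemma area_inequality_log_coeffs:
  assumes L: "L holomorphic_on ball 0 1" "L 0 = 0" and inj: "inj_on (\<lambda>z. z * exp (L z)) (ball 0 1)"
  defines "g \<equiv> \<lambda>k. (deriv ^^ k) L 0 / (2 * fact k)"
  shows "(cmod (g 1))\<^sup>2 + 3 * (cmod (g 2 - g 1 ^ 2 / 2))\<^sup>2 +
    5 * (cmod (g 3 - g 1 * g 2 + g 1 ^ 3 / 6))\<^sup>2 \<le> 1"
proof -
  define c where "c k s = (deriv ^^ k) (\<lambda>z. exp (- of_real s * L z)) 0 / fact k" for k and s :: real
  have c: "c 0 s = 1" "c 1 s = - 2 * of_real s * g 1"
    "c 2 s = - 2 * of_real s * g 2 + 2 * of_real s ^ 2 * g 1 ^ 2"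
    "c 3 s = - 2 * of_real s * g 3 + 4 * of_real s ^ 2 * g 1 * g 2 - 4 / 3 * of_real s ^ 3 * g 1 ^ 3" for s
    using exp_coeffs_upto_3[OF L(1) zero_less_one L(2), of s] unfolding c_def g_def by blast+
  define G where "G s = - s + (1 - s) * (cmod (c 1 s))\<^sup>2 + (2 - s) * (cmod (c 2 s))\<^sup>2 + (3 - s) * (cmod (c 3 s))\<^sup>2" for s
  have "G s \<le> 0" if "0 < s" "s < 1 / 2" for s
  proof -
    have "(\<Sum>k\<le>3. (k - s) * (cmod (c k s))\<^sup>2) \<le> 0"
      unfolding c_def using area_inequality_exponent_lt_half[OF L inj that, where N = 3]
      by (simp only: of_real_minus)
    then show ?thesis
      by (simp add: G_def c(1) numeral_3_eq_3 numeral_2_eq_2)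
  qed
  moreover have "eventually (\<lambda>s :: real. 0 < s \<and> s < 1 / 2) (at_left (1 / 2))"
    using eventually_at_left_real[of 0 "1 / 2 :: real"] by (auto elim!: eventually_mono)
  ultimately have "eventually (\<lambda>s. G s \<le> 0) (at_left (1 / 2))"
    by (auto elim!: eventually_mono)
  moreover have "(G \<longlongrightarrow> G (1 / 2)) (at_left (1 / 2))"
    unfolding G_def c by (intro tendsto_intros)
  ultimately have "G (1 / 2) \<le> 0"
    by (auto dest: tendsto_upperbound)
  moreover have "c 1 (1 / 2) = - g 1" unfolding c by simp
  moreover have "c 2 (1 / 2) = - (g 2 - g 1 ^ 2 / 2)" unfolding c by (simp add: field_simps power2_eq_square)
  moreover have "c 3 (1 / 2) = - (g 3 - g 1 * g 2 + g 1 ^ 3 / 6)"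
    unfolding c by (simp add: field_simps power2_eq_square power3_eq_cube)
  ultimately show ?thesis
    unfolding G_def by (simp only: norm_minus_cancel) simp
qed

text \<open>The description by \<open>THE\<close> needs existence, from a holomorphic logarithm of
  the zero-free function \<open>f z / z\<close> on the convex disc, and uniqueness as a total
  function, for which the values outside the disc are fixed to be 0.\<close>

lemma log_branch_spec:
  assumes "f \<in> class_S"
  shows "log_branch f holomorphic_on ball 0 1" "log_branch f 0 = 0"
    and "\<And>z. z \<in> ball 0 1 \<Longrightarrow> f z = z * exp (log_branch f z)"
proof -
  let ?spec = "\<lambda>L. L holomorphic_on ball 0 1 \<and> L 0 = 0 \<and>
      (\<forall>z\<in>ball 0 1. z \<noteq> 0 \<longrightarrow> exp (L z) = f z / z) \<and> (\<forall>z. z \<notin> ball 0 1 \<longrightarrow> L z = 0)"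
  have f: "f holomorphic_on ball 0 1" "inj_on f (ball 0 1)" "f 0 = 0" "deriv f 0 = 1"
    using assms by (auto simp: class_S_def)
  define g where "g = (\<lambda>z. if z = 0 then deriv f 0 else (f z - f 0) / (z - 0))"
  have g: "g holomorphic_on ball 0 1"
    unfolding g_def using f(1) by (intro pole_lemma) auto
  have "g z \<noteq> 0" if "z \<in> ball 0 1" for z
    using inj_onD[OF f(2), of z 0] that f by (auto simp: g_def)
  then obtain h where h: "h holomorphic_on ball 0 1" "\<And>z. z \<in> ball 0 1 \<Longrightarrow> g z = exp (h z)"
    using contractible_imp_holomorphic_log[OF g convex_imp_contractible[OF convex_ball]] by metis
  have h0: "exp (h 0) = 1" using h(2)[of 0] f by (simp add: g_def)
  \<comment> \<open>Subtracting \<open>h 0\<close> normalises the value at 0 and leaves the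
    exponential unchanged, since \<open>exp (h 0) = 1\<close>.\<close>
  define L0 where "L0 = (\<lambda>z. if z \<in> ball 0 1 then h z - h 0 else 0)"
  have "L0 holomorphic_on ball 0 1"
    by (rule holomorphic_transform[of "\<lambda>z. h z - h 0"]) (auto simp: L0_def intro!: holomorphic_intros h)
  moreover have "exp (L0 z) = f z / z" if "z \<in> ball 0 1" "z \<noteq> 0" for z
    using that h(2)[of z] f by (simp add: L0_def exp_diff h0 g_def)
  ultimately have ex: "?spec L0" by (auto simp: L0_def)
  have uniq: "L = L0" if L: "?spec L" for L
  proof
    fix z
    show "L z = L0 z"
    proof (cases "z \<in> ball 0 1")
      case True
      have exp_eq: "exp (L w) = g w" if "w \<in> ball 0 1" "?spec L" for w L
        using that f by (cases "w = 0") (auto simp: g_def)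
      \<comment> \<open>Any two candidates have derivative \<open>deriv g w / g w\<close>, so they
        differ by a constant, which is 0 by the value at 0.\<close>
      have "\<exists>k. \<forall>w\<in>ball 0 1. L w - L0 w = k"
      proof (rule has_field_derivative_zero_constant)
        fix w :: complex assume w: "w \<in> ball 0 1"
        have d: "(M has_field_derivative deriv g w / g w) (at w)" if M: "?spec M" for M
        proof -
          have 1: "(M has_field_derivative deriv M w) (at w)"
            using M w by (intro holomorphic_derivI[of _ "ball 0 1"]) auto
          have 2: "(g has_field_derivative deriv g w) (at w)"
            using g w by (intro holomorphic_derivI[of _ "ball 0 1"]) auto
          have "((\<lambda>x. exp (M x)) has_field_derivative exp (M w) * deriv M w) (at w)"
            using DERIV_chain2[OF DERIV_exp 1] .
          then have "(g has_field_derivative exp (M w) * deriv M w) (at w)"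
            by (rule has_field_derivative_transform_within_open[where S = "ball 0 1"])
               (use w exp_eq[OF _ M] in \<open>simp_all only: open_ball\<close>)
          from DERIV_unique[OF 2 this] have "deriv M w = deriv g w / g w"
            unfolding exp_eq[OF w M, symmetric] by simp
          then show ?thesis using 1 by simp
        qed
        show "((\<lambda>w. L w - L0 w) has_field_derivative 0) (at w within ball 0 1)"
          using DERIV_diff[OF d[OF L] d[OF ex]] by (auto intro: has_field_derivative_at_within)
      qed auto
      then obtain k where k: "\<And>w. w \<in> ball 0 1 \<Longrightarrow> L w - L0 w = k" by blast
      from k[of 0] k[OF True] show ?thesis using L ex by simp
    qed (use L ex in auto)
  qed
  have spec: "?spec (log_branch f)"
    unfolding log_branch_def by (rule theI[of ?spec, OF ex uniq])
  then show "log_branch f holomorphic_on ball 0 1" "log_branch f 0 = 0" by auto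
  show "f z = z * exp (log_branch f z)" if "z \<in> ball 0 1" for z
    using spec that f by (cases "z = 0") auto
qed

section \<open>Elementary estimates for the final bound\<close>

lemma norm_diff_le_of_area_inequality:
  fixes g1 g2 g3 :: complex
  assumes "(cmod g1)\<^sup>2 + 5 * (cmod (g3 - g1 * g2 + g1 ^ 3 / 6))\<^sup>2 \<le> 1"
  shows "cmod g3 - cmod g2 \<le> 1 / sqrt 5"
proof -
  define a w where "a = cmod g1" and "w = cmod (g3 - g1 * g2 + g1 ^ 3 / 6)"
  have aw: "a\<^sup>2 + 5 * w\<^sup>2 \<le> 1" "0 \<le> a" "0 \<le> w" using assms by (auto simp: a_def w_def)
  then have "a\<^sup>2 \<le> 1" using zero_le_power2[of w] by linarith
  then have a1: "a \<le> 1" using aw by (simp add: power_le_one_iff)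
  have "g3 = (g3 - g1 * g2 + g1 ^ 3 / 6) + (g1 * g2 - g1 ^ 3 / 6)" by simp
  then have "cmod g3 \<le> w + cmod (g1 * g2 - g1 ^ 3 / 6)"
    unfolding w_def by (metis norm_triangle_ineq)
  also have "cmod (g1 * g2 - g1 ^ 3 / 6) \<le> a * cmod g2 + a ^ 3 / 6"
    using norm_triangle_ineq4[of "g1 * g2" "g1 ^ 3 / 6"] by (simp add: a_def norm_mult norm_divide norm_power)
  also have "a * cmod g2 \<le> cmod g2" using a1 aw by (simp add: mult_left_le_one_le)
  finally have "cmod g3 - cmod g2 \<le> w + a ^ 3 / 6" by simp
  also have "a ^ 3 \<le> a\<^sup>2" using a1 aw by (intro power_decreasing) auto
  \<comment> \<open>The constant is weakened so that this term cancels against the bound for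
    \<open>w\<close> below.\<close>
  also have "a\<^sup>2 / 6 \<le> a\<^sup>2 / (2 * sqrt 5)"
  proof -
    have "sqrt 5 \<le> 3" by (rule real_le_lsqrt) auto
    then show ?thesis by (intro divide_left_mono) auto
  qed
  \<comment> \<open>This is \<open>sqrt (1 - x) \<le> 1 - x / 2\<close> with \<open>x\<close> the
    square of \<open>a\<close>, proved by comparing squares.\<close>
  also have "w \<le> (1 - a\<^sup>2 / 2) / sqrt 5"
  proof -
    have "(sqrt 5 * w)\<^sup>2 = 5 * w\<^sup>2" "(1 - a\<^sup>2 / 2)\<^sup>2 = 1 - a\<^sup>2 + (a\<^sup>2 / 2)\<^sup>2" "0 \<le> (a\<^sup>2 / 2)\<^sup>2"
      by (simp_all add: power_mult_distrib power2_diff)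
    then have "(sqrt 5 * w)\<^sup>2 \<le> (1 - a\<^sup>2 / 2)\<^sup>2"
      using aw(1) by linarith
    then have "sqrt 5 * w \<le> 1 - a\<^sup>2 / 2"
      by (rule power2_le_imp_le) (use \<open>a\<^sup>2 \<le> 1\<close> in simp)
    then show ?thesis by (simp add: field_simps)
  qed
  finally show ?thesis by (simp add: field_simps)
qed

theorem theorem1:
  assumes "f \<in> class_S"
  shows "cmod (log_coeff f 3) - cmod (log_coeff f 2) \<le> 1 / sqrt 5"
proof -
  note L = log_branch_spec[OF assms]
  have "inj_on f (ball 0 1)" using assms by (simp add: class_S_def)
  then have inj: "inj_on (\<lambda>z. z * exp (log_branch f z)) (ball 0 1)"
    using inj_on_cong[of "ball 0 1" f, OF L(3)] by blast
  from area_inequality_log_coeffs[OF L(1,2) inj]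
  have "(cmod (log_coeff f 1))\<^sup>2 + 3 * (cmod (log_coeff f 2 - log_coeff f 1 ^ 2 / 2))\<^sup>2 +
      5 * (cmod (log_coeff f 3 - log_coeff f 1 * log_coeff f 2 + log_coeff f 1 ^ 3 / 6))\<^sup>2 \<le> 1"
    by (simp only: log_coeff_def of_nat_fact)
  then show ?thesis
    \<comment> \<open>The middle square, with weight 3, is dropped.\<close>
    by (intro norm_diff_le_of_area_inequality[of "log_coeff f 1"]) (smt (verit) zero_le_power2)
qed

end
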